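(* Let $A_h(\boldsymbol k)=B_h(\boldsymbol k)C_hB_h(\boldsymbol k)^H\in\mathbb C^{3n\times 3n}$ and $M_h\in\mathbb C^{3n\times 3n}$ be the matrices described in the context. Assume that $n_1,n_2,n_3$ are even and that the stiffness matrix $C_h$ and the mass matrix $M_h$ are nodewise local multiplication matrices. Then $$A_h(\boldsymbol k)\,\Gamma_a^{(v)}=\Gamma_a^{(v)}A_h(\boldsymbol k),\qquad M_h\,\Gamma_a^{(v)}=\Gamma_a^{(v)}M_h,\qquad a\in\{12,13\}.$$ Consequently, the velocity space $\mathbb C^{3n}$ is the orthogonal direct sum of the four common eigenspaces $$\mathcal V_{\sigma_{12},\sigma_{13}}=\{v\in\mathbb C^{3n}:\ \Gamma_{12}^{(v)}v=\sigma_{12}v,\ \Gamma_{13}^{(v)}v=\sigma_{13}v\},\qquad (\sigma_{12},\sigma_{13})\in\{+1,-1\}^2,$$ and both $A_h(\boldsymbol k)$ and $M_h$ leave each of these four subspaces invariant.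
   Context: Grid and Bloch shifts. Let $n_1,n_2,n_3$ be positive integers (numbers of grid points in three lattice directions), $n=n_1n_2n_3$, and let $h_1,h_2,h_3>0$ be grid spacings, $h_d=\sqrt{h_1^2+h_2^2+h_3^2}$. Let $\boldsymbol k=(\kappa_1,\kappa_2,\kappa_3)\in\mathbb R^3$ be a reduced Bloch vector and $\phi_\ell=2\pi\kappa_\ell$. Let $A_{\rm lat}=[\boldsymbol a_1,\boldsymbol a_2,\boldsymbol a_3]\in\mathbb R^{3\times3}$ be the invertible matrix of primitive lattice vectors. Vectors in $\mathbb C^n$ are scalar functions $w(i,j,k)$ on the grid $0\le i<n_1$, $0\le j<n_2$, $0\le k<n_3$, ordered with $i$ fastest and $k$ slowest. Define the $n_\ell\times n_\ell$ matrices $$K_\ell=\begin{pmatrix}0&I_{n_\ell-1}\\ e^{\mathrm i\phi_\ell}&0\end{pmatrix},\quad \ell=1,2,3,$$ and $H_1=I_{n_3}\otimes I_{n_2}\otimes K_1$, $H_2=I_{n_3}\otimes K_2\otimes I_{n_1}$, $H_3=K_3\otimes I_{n_2}\otimes I_{n_1}$. Body-diagonal shifts and differences: $S_{d_1}=H_3H_2H_1$, $S_{d_2}=H_3^{-1}H_2H_1$, $S_{d_3}=H_3H_2^{-1}H_1$, $S_{d_4}=H_3^{-1}H_2^{-1}H_1$, and $D_{d_\ell}=(S_{d_\ell}-I)/h_d$ for $\ell=1,2,3,4$. Reconstructed derivatives: $$\widetilde D_1=\tfrac{h_d}{4h_1}(D_{d_1}+D_{d_2}+D_{d_3}+D_{d_4}),\quad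 \widetilde D_2=\tfrac{h_d}{4h_2}(D_{d_1}+D_{d_2}-D_{d_3}-D_{d_4}),\quad \widetilde D_3=\tfrac{h_d}{4h_3}(D_{d_1}-D_{d_2}+D_{d_3}-D_{d_4}),$$ $\widehat{\mathcal D}_s=-\mathrm i\,\widetilde D_s$ for $s=1,2,3$, and $\mathcal D_m=\sum_{s=1}^3(A_{\rm lat}^{-1})_{sm}\widehat{\mathcal D}_s$ for $m=1,2,3$. Discrete divergence matrix ($3n\times 6n$, blocks of size $n\times n$): $$B_h(\boldsymbol k)=\begin{bmatrix}\mathcal D_1&0&0&0&\mathcal D_3&\mathcal D_2\\0&\mathcal D_2&0&\mathcal D_3&0&\mathcal D_1\\0&0&\mathcal D_3&\mathcal D_2&\mathcal D_1&0\end{bmatrix}.$$ The superscript $H$ denotes the conjugate transpose. Material matrices: $C_h\in\mathbb C^{6n\times6n}$ is the discrete stiffness matrix and $M_h\in\mathbb C^{3n\times3n}$ the discrete mass matrix. Vectors in $\mathbb C^{3n}=\mathbb C^3\otimes\mathbb C^n$ and $\mathbb C^{6n}=\mathbb C^6\otimes\mathbb C^n$ are ordered by component first, i.e. they consist of 3 (resp. 6) stacked grid functions. "Nodewise local multiplication matrix" means that the matrix acts independently at each grid node: $C_h$ multiplies the 6 components at each node $x$ by a $6\times6$ matrix depending only on $x$, and $M_h$ multiplies the 3 components at each node $x$ by a $3\times3$ matrix depending only on $x$ (equivalently, every $n\times n$ component block is diagonal). The matrices at different nodes may differ. Parity operators: on $\mathbb C^n$, $(\Gamma_{12}w)(i,j,k)=(-1)^{i+j}w(i,j,k)$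 and $(\Gamma_{13}w)(i,j,k)=(-1)^{i+k}w(i,j,k)$; lifted to $\mathbb C^{3n}$ by $\Gamma_a^{(v)}=I_3\otimes\Gamma_a$, $a\in\{12,13\}$. Orthogonality is with respect to the standard Hermitian inner product. *)

theory Defs
  imports Complex_Main
    "Jordan_Normal_Form.Gauss_Jordan_Elimination"
    "Jordan_Normal_Form.Schur_Decomposition"
    "Jordan_Normal_Form.VS_Connect"
begin

text \<open>
  Triples of data attached to the three lattice directions (grid sizes \<open>n\<close>, spacings \<open>h\<close>,
  reduced Bloch vector \<open>\<kappa>\<close>) are functions on \<^typ>\<open>nat\<close> of which only the values at
  \<open>1, 2, 3\<close> are used. Matrix and vector entries are indexed from 0.

  The grid node \<open>(i, j, k)\<close> has number \<open>i + n 1 * (j + n 2 * k)\<close>, so \<open>i\<close> is fastest; the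
  Kronecker product below makes the last factor fastest.
\<close>

definition kron :: "'a::semiring_0 mat \<Rightarrow> 'a mat \<Rightarrow> 'a mat" where
  "kron A B = mat (dim_row A * dim_row B) (dim_col A * dim_col B)
     (\<lambda>(r, c). A $$ (r div dim_row B, c div dim_col B) * B $$ (r mod dim_row B, c mod dim_col B))"

definition block_mat :: "nat \<Rightarrow> 'a mat list list \<Rightarrow> 'a mat" where
  "block_mat m Bs = mat (length Bs * m) (length (hd Bs) * m)
     (\<lambda>(r, c). (Bs ! (r div m) ! (c div m)) $$ (r mod m, c mod m))"

text \<open>Meaningful for invertible matrices only.\<close>
definition minv :: "'a::field mat \<Rightarrow> 'a mat" where
  "minv A = the (mat_inverse A)"

definition gridsize :: "(nat \<Rightarrow> nat) \<Rightarrow> nat" where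
  "gridsize n = n 1 * n 2 * n 3"

definition Kmat :: "nat \<Rightarrow> real \<Rightarrow> complex mat" where
  "Kmat m \<phi> = four_block_mat
     (0\<^sub>m (m - 1) 1)                                   (1\<^sub>m (m - 1))
     (mat 1 1 (\<lambda>_. exp (\<i> * complex_of_real \<phi>)))  (0\<^sub>m 1 (m - 1))"

definition Bloch_K :: "(nat \<Rightarrow> nat) \<Rightarrow> (nat \<Rightarrow> real) \<Rightarrow> nat \<Rightarrow> complex mat" where
  "Bloch_K n \<kappa> l = Kmat (n l) (2 * pi * \<kappa> l)"

definition H1 :: "(nat \<Rightarrow> nat) \<Rightarrow> (nat \<Rightarrow> real) \<Rightarrow> complex mat" where
  "H1 n \<kappa> = kron (kron (1\<^sub>m (n 3)) (1\<^sub>m (n 2))) (Bloch_K n \<kappa> 1)"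

definition H2 :: "(nat \<Rightarrow> nat) \<Rightarrow> (nat \<Rightarrow> real) \<Rightarrow> complex mat" where
  "H2 n \<kappa> = kron (kron (1\<^sub>m (n 3)) (Bloch_K n \<kappa> 2)) (1\<^sub>m (n 1))"

definition H3 :: "(nat \<Rightarrow> nat) \<Rightarrow> (nat \<Rightarrow> real) \<Rightarrow> complex mat" where
  "H3 n \<kappa> = kron (kron (Bloch_K n \<kappa> 3) (1\<^sub>m (n 2))) (1\<^sub>m (n 1))"

definition Sd1 :: "(nat \<Rightarrow> nat) \<Rightarrow> (nat \<Rightarrow> real) \<Rightarrow> complex mat" where
  "Sd1 n \<kappa> = H3 n \<kappa> * H2 n \<kappa> * H1 n \<kappa>"

definition Sd2 :: "(nat \<Rightarrow> nat) \<Rightarrow> (nat \<Rightarrow> real) \<Rightarrow> complex mat" where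
  "Sd2 n \<kappa> = minv (H3 n \<kappa>) * H2 n \<kappa> * H1 n \<kappa>"

definition Sd3 :: "(nat \<Rightarrow> nat) \<Rightarrow> (nat \<Rightarrow> real) \<Rightarrow> complex mat" where
  "Sd3 n \<kappa> = H3 n \<kappa> * minv (H2 n \<kappa>) * H1 n \<kappa>"

definition Sd4 :: "(nat \<Rightarrow> nat) \<Rightarrow> (nat \<Rightarrow> real) \<Rightarrow> complex mat" where
  "Sd4 n \<kappa> = minv (H3 n \<kappa>) * minv (H2 n \<kappa>) * H1 n \<kappa>"

definition diag_spacing :: "(nat \<Rightarrow> real) \<Rightarrow> real" where
  "diag_spacing h = sqrt ((h 1)\<^sup>2 + (h 2)\<^sup>2 + (h 3)\<^sup>2)"

text \<open>\<open>(S - I) / h\<^sub>d\<close> for a shift \<open>S\<close>\<close>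
definition diag_diff :: "(nat \<Rightarrow> nat) \<Rightarrow> (nat \<Rightarrow> real) \<Rightarrow> complex mat \<Rightarrow> complex mat" where
  "diag_diff n h S = complex_of_real (1 / diag_spacing h) \<cdot>\<^sub>m (S - 1\<^sub>m (gridsize n))"

definition Dtilde :: "(nat \<Rightarrow> nat) \<Rightarrow> (nat \<Rightarrow> real) \<Rightarrow> (nat \<Rightarrow> real) \<Rightarrow> nat \<Rightarrow> complex mat" where
  "Dtilde n h \<kappa> s =
     (let D1 = diag_diff n h (Sd1 n \<kappa>); D2 = diag_diff n h (Sd2 n \<kappa>);
          D3 = diag_diff n h (Sd3 n \<kappa>); D4 = diag_diff n h (Sd4 n \<kappa>)
      in complex_of_real (diag_spacing h / (4 * h s)) \<cdot>\<^sub>m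
          (if s = 1 then D1 + D2 + D3 + D4
           else if s = 2 then D1 + D2 - D3 - D4
           else D1 - D2 + D3 - D4))"

definition Dhat :: "(nat \<Rightarrow> nat) \<Rightarrow> (nat \<Rightarrow> real) \<Rightarrow> (nat \<Rightarrow> real) \<Rightarrow> nat \<Rightarrow> complex mat" where
  "Dhat n h \<kappa> s = (- \<i>) \<cdot>\<^sub>m Dtilde n h \<kappa> s"

text \<open>The columns of \<open>Alat\<close> are the primitive lattice vectors; the entry \<open>(s, m)\<close> of its
  inverse, counted from 1, is \<open>(s - 1, m - 1)\<close> here.\<close>
definition Dcal ::
  "(nat \<Rightarrow> nat) \<Rightarrow> (nat \<Rightarrow> real) \<Rightarrow> (nat \<Rightarrow> real) \<Rightarrow> real mat \<Rightarrow> nat \<Rightarrow> complex mat" where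
  "Dcal n h \<kappa> Alat m =
     complex_of_real (minv Alat $$ (0, m - 1)) \<cdot>\<^sub>m Dhat n h \<kappa> 1 +
     complex_of_real (minv Alat $$ (1, m - 1)) \<cdot>\<^sub>m Dhat n h \<kappa> 2 +
     complex_of_real (minv Alat $$ (2, m - 1)) \<cdot>\<^sub>m Dhat n h \<kappa> 3"

definition Bh :: "(nat \<Rightarrow> nat) \<Rightarrow> (nat \<Rightarrow> real) \<Rightarrow> (nat \<Rightarrow> real) \<Rightarrow> real mat \<Rightarrow> complex mat" where
  "Bh n h \<kappa> Alat =
     (let D = Dcal n h \<kappa> Alat; Z = 0\<^sub>m (gridsize n) (gridsize n) in
      block_mat (gridsize n)
        [[D 1, Z,   Z,   Z,   D 3, D 2],
         [Z,   D 2, Z,   D 3, Z,   D 1],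
         [Z,   Z,   D 3, D 2, D 1, Z  ]])"

definition Ah ::
  "(nat \<Rightarrow> nat) \<Rightarrow> (nat \<Rightarrow> real) \<Rightarrow> (nat \<Rightarrow> real) \<Rightarrow> real mat \<Rightarrow> complex mat \<Rightarrow> complex mat" where
  "Ah n h \<kappa> Alat C = Bh n h \<kappa> Alat * C * mat_adjoint (Bh n h \<kappa> Alat)"

text \<open>The \<open>r\<close> components at node \<open>x\<close> of a vector consisting of \<open>r\<close> stacked grid functions
  on \<open>N\<close> nodes.\<close>
definition node_values :: "nat \<Rightarrow> nat \<Rightarrow> 'a vec \<Rightarrow> nat \<Rightarrow> 'a vec" where
  "node_values N r v x = vec r (\<lambda>c. v $ (c * N + x))"

definition nodewise_local :: "nat \<Rightarrow> nat \<Rightarrow> complex mat \<Rightarrow> bool" where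
  "nodewise_local N r C \<longleftrightarrow> C \<in> carrier_mat (r * N) (r * N) \<and>
     (\<exists>L. (\<forall>x<N. L x \<in> carrier_mat r r) \<and>
       (\<forall>v \<in> carrier_vec (r * N). \<forall>x<N.
          node_values N r (C *\<^sub>v v) x = L x *\<^sub>v node_values N r v x))"

definition parity12 :: "(nat \<Rightarrow> nat) \<Rightarrow> complex mat" where
  "parity12 n = mat_diag (gridsize n) (\<lambda>p. (- 1) ^ (p mod n 1 + p div n 1 mod n 2))"

definition parity13 :: "(nat \<Rightarrow> nat) \<Rightarrow> complex mat" where
  "parity13 n = mat_diag (gridsize n) (\<lambda>p. (- 1) ^ (p mod n 1 + p div (n 1 * n 2)))"

definition parity12_v :: "(nat \<Rightarrow> nat) \<Rightarrow> complex mat" where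
  "parity12_v n = kron (1\<^sub>m 3) (parity12 n)"

definition parity13_v :: "(nat \<Rightarrow> nat) \<Rightarrow> complex mat" where
  "parity13_v n = kron (1\<^sub>m 3) (parity13 n)"

definition parity_space :: "(nat \<Rightarrow> nat) \<Rightarrow> complex \<Rightarrow> complex \<Rightarrow> complex vec set" where
  "parity_space n \<sigma>12 \<sigma>13 = {v \<in> carrier_vec (3 * gridsize n).
     parity12_v n *\<^sub>v v = \<sigma>12 \<cdot>\<^sub>v v \<and> parity13_v n *\<^sub>v v = \<sigma>13 \<cdot>\<^sub>v v}"

definition orthogonal_direct_sum :: "nat \<Rightarrow> 'i set \<Rightarrow> ('i \<Rightarrow> complex vec set) \<Rightarrow> bool" where
  "orthogonal_direct_sum m I V \<longleftrightarrow>
     (\<forall>i\<in>I. VectorSpace.subspace class_ring (V i) (module_vec TYPE(complex) m)) \<and>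
     (\<forall>i\<in>I. \<forall>j\<in>I. i \<noteq> j \<longrightarrow> (\<forall>v\<in>V i. \<forall>w\<in>V j. v \<bullet>c w = 0)) \<and>
     (\<forall>v\<in>carrier_vec m. \<exists>!f. f \<in> (\<Pi>\<^sub>E i\<in>I. V i) \<and> v = finsum_vec TYPE(complex) m f I)"

text \<open>Check of the node numbering and of the parity signs.\<close>

lemma grid_coords:
  fixes n :: "nat \<Rightarrow> nat"
  assumes "i < n 1" "j < n 2" "k < n 3"
  defines "p \<equiv> i + n 1 * (j + n 2 * k)"
  shows "p < gridsize n" "p mod n 1 = i" "p div n 1 mod n 2 = j" "p div (n 1 * n 2) = k"
proof -
  have lin: "a + b * c < b * d" if "a < b" "c < d" for a b c d :: nat
  proof -
    have "a + b * c < b * Suc c" using that by simp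
    also have "\<dots> \<le> b * d" using that by (intro mult_le_mono2) simp
    finally show ?thesis .
  qed
  show "p < gridsize n"
    unfolding p_def gridsize_def mult.assoc by (intro lin assms)
  show "p mod n 1 = i" "p div n 1 mod n 2 = j" "p div (n 1 * n 2) = k"
    using assms by (auto simp: p_def div_mult2_eq)
qed

lemma parity_apply:
  assumes "i < n 1" "j < n 2" "k < n 3" "w \<in> carrier_vec (gridsize n)"
  defines "p \<equiv> i + n 1 * (j + n 2 * k)"
  shows "(parity12 n *\<^sub>v w) $ p = (- 1) ^ (i + j) * w $ p"
    and "(parity13 n *\<^sub>v w) $ p = (- 1) ^ (i + k) * w $ p"
proof -
  have diag: "(mat_diag m f *\<^sub>v v) $ q = f q * v $ q"
    if "q < m" "v \<in> carrier_vec m" for m q f and v :: "complex vec"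
    using that by (simp add: mat_diag_def scalar_prod_def if_distrib[of "\<lambda>x. x * _"] 
        sum.delta cong: if_cong)
  note c = grid_coords[of i n j k, OF assms(1-3), folded p_def]
  show "(parity12 n *\<^sub>v w) $ p = (- 1) ^ (i + j) * w $ p"
    unfolding parity12_def using diag[OF c(1) assms(4)] c by simp
  show "(parity13 n *\<^sub>v w) $ p = (- 1) ^ (i + k) * w $ p"
    unfolding parity13_def using diag[OF c(1) assms(4)] c by simp
qed

end

theory Submission
  imports Defs
begin

text \<open>
  A step in lattice direction \<open>l\<close> flips the parity of the \<open>l\<close>-th node coordinate; since
  \<open>n l\<close> is even, this remains true when the step wraps around the Bloch-periodic boundary
  from \<open>n l - 1\<close> to \<open>0\<close>. Hence each shift commutes or anticommutes with each
  parity operator: \<open>\<Gamma>\<^sub>1\<^sub>2\<close> anticommutes with \<open>H\<^sub>1, H\<^sub>2\<close> and commutes with \<open>H\<^sub>3\<close>,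
  while \<open>\<Gamma>\<^sub>1\<^sub>3\<close> anticommutes with \<open>H\<^sub>1, H\<^sub>3\<close> and commutes with \<open>H\<^sub>2\<close>
  (\<open>parity_commutes_upto_H\<close>). A body-diagonal shift is one forward or backward step in every
  direction, and inverting a step does not change its sign, so all four body-diagonal shifts
  collect exactly two minus signs and commute with both parities. The same then holds for the
  linear combinations \<open>D\<^sub>m\<close> of these shifts and the identity (\<open>Dcal_commutes\<close>).

  The parities are diagonal with entries \<open>\<plusminus>1\<close>, repeated in every component of a stacked grid
  function. So they pass through \<open>B\<^sub>h\<close>, whose blocks are the \<open>D\<^sub>m\<close> and zero, through its
  adjoint because they are real, and through nodewise local matrices because these never couple
  different nodes. This gives the commutation with \<open>A\<^sub>h\<close> and \<open>M\<^sub>h\<close>, and commuting matrices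
  preserve each other's eigenspaces.

  The common eigenspace for \<open>(\<sigma>\<^sub>1\<^sub>2, \<sigma>\<^sub>1\<^sub>3)\<close> consists of the vectors supported on the
  nodes whose two signs are \<open>(\<sigma>\<^sub>1\<^sub>2, \<sigma>\<^sub>1\<^sub>3)\<close>. The four sign pairs partition the coordinates,
  which makes the decomposition direct and orthogonal (\<open>orthogonal_direct_sum_labels\<close>).
\<close>

section \<open>Matrices that commute up to a sign\<close>

definition commutes_upto :: "nat \<Rightarrow> complex \<Rightarrow> complex mat \<Rightarrow> complex mat \<Rightarrow> bool" where
  "commutes_upto N s G X \<longleftrightarrow>
     G \<in> carrier_mat N N \<and> X \<in> carrier_mat N N \<and> G * X = s \<cdot>\<^sub>m (X * G)"

lemma commutes_upto_one: "G \<in> carrier_mat N N \<Longrightarrow> commutes_upto N 1 G (1\<^sub>m N)"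
  by (auto simp: commutes_upto_def intro!: eq_matI)

lemma commutes_upto_add:
  assumes "commutes_upto N s G X" "commutes_upto N s G Y"
  shows "commutes_upto N s G (X + Y)"
  using assms
  by (auto simp: commutes_upto_def mult_add_distrib_mat[of _ N N] add_mult_distrib_mat[of _ N N]
      add_smult_distrib_left_mat[of _ N N])

lemma commutes_upto_smult:
  assumes "commutes_upto N s G X"
  shows "commutes_upto N s G (a \<cdot>\<^sub>m X)"
  using assms
  by (auto simp: commutes_upto_def mult_smult_distrib[of _ N N] mult_smult_assoc_mat[of _ N N]
      intro!: eq_matI)

lemma commutes_upto_diff:
  assumes "commutes_upto N s G X" "commutes_upto N s G Y"
  shows "commutes_upto N s G (X - Y)"
proof -
  have "X - Y = X + (- 1) \<cdot>\<^sub>m Y"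
    using assms by (auto simp: commutes_upto_def intro!: eq_matI)
  with assms show ?thesis
    by (auto intro: commutes_upto_add commutes_upto_smult)
qed

lemma commutes_upto_mult:
  assumes "commutes_upto N s G X" "commutes_upto N t G Y"
  shows "commutes_upto N (s * t) G (X * Y)"
proof -
  have [simp]: "G \<in> carrier_mat N N" "X \<in> carrier_mat N N" "Y \<in> carrier_mat N N"
    and X: "G * X = s \<cdot>\<^sub>m (X * G)" and Y: "G * Y = t \<cdot>\<^sub>m (Y * G)"
    using assms by (auto simp: commutes_upto_def)
  have "G * (X * Y) = G * X * Y"
    by (simp add: assoc_mult_mat[of _ N N _ N _ N])
  also have "\<dots> = s \<cdot>\<^sub>m (X * (G * Y))"
    unfolding X by (subst mult_smult_assoc_mat[of _ N N _ N])
      (simp_all add: assoc_mult_mat[of _ N N _ N _ N] mult_carrier_mat[of _ N N _ N])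
  also have "\<dots> = (s * t) \<cdot>\<^sub>m (X * (Y * G))"
    unfolding Y by (subst mult_smult_distrib[of _ N N _ N])
      (auto simp: mult_carrier_mat[of _ N N _ N] intro!: eq_matI)
  also have "X * (Y * G) = X * Y * G"
    by (simp add: assoc_mult_mat[of _ N N _ N _ N])
  finally show ?thesis
    by (simp add: commutes_upto_def mult_carrier_mat[of _ N N _ N])
qed

text \<open>
  \<open>minv\<close> unwraps an optional inverse, so nothing is known about it before the matrix is shown to
  be invertible. For square matrices over a field an inverse on one side is enough, and this
  one-sided form is easy to carry through Kronecker products.
\<close>

definition right_invertible :: "nat \<Rightarrow> complex mat \<Rightarrow> bool" where
  "right_invertible N X \<longleftrightarrow>
     X \<in> carrier_mat N N \<and> (\<exists>Y \<in> carrier_mat N N. X * Y = 1\<^sub>m N)"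

lemma minv_inverse:
  assumes "right_invertible N A"
  shows "minv A \<in> carrier_mat N N" "A * minv A = 1\<^sub>m N" "minv A * A = 1\<^sub>m N"
proof -
  from assms obtain B where A: "A \<in> carrier_mat N N" and B: "B \<in> carrier_mat N N"
    and AB: "A * B = 1\<^sub>m N"
    by (auto simp: right_invertible_def)
  have "A \<in> Units (ring_mat TYPE(complex) N undefined)"
    using A B AB mat_mult_left_right_inverse[OF A B AB]
    by (auto simp: Units_def ring_mat_simps)
  then obtain A' where A': "mat_inverse A = Some A'"
    using mat_inverse(1)[OF A, of undefined] by (cases "mat_inverse A") auto
  show "minv A \<in> carrier_mat N N" "A * minv A = 1\<^sub>m N" "minv A * A = 1\<^sub>m N"
    using mat_inverse(2)[OF A A'] by (simp_all add: minv_def A')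
qed

text \<open>
  Multiplying \<open>G * X = s \<cdot>\<^sub>m (X * G)\<close> by the inverse of \<open>X\<close> on both sides moves \<open>s\<close> to the
  other side of the relation, where it is \<open>1 / s\<close>; a sign is its own reciprocal.
\<close>

lemma commutes_upto_minv:
  assumes X: "commutes_upto N s G X" and s: "s * s = 1"
    and rinv: "right_invertible N X"
  shows "commutes_upto N s G (minv X)"
proof -
  have [simp]: "G \<in> carrier_mat N N" "X \<in> carrier_mat N N"
    and GX: "G * X = s \<cdot>\<^sub>m (X * G)"
    using X by (auto simp: commutes_upto_def)
  note inv = minv_inverse[OF rinv]
  note [simp] = inv(1)
  have "G * minv X = (minv X * X) * (G * minv X)"
    by (simp add: inv left_mult_one_mat[of _ N N] mult_carrier_mat[of _ N N _ N])
  also have "\<dots> = minv X * (X * G) * minv X"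
    by (simp add: assoc_mult_mat[of _ N N _ N _ N] mult_carrier_mat[of _ N N _ N])
  also have "X * G = s \<cdot>\<^sub>m (G * X)"
    unfolding GX using s by (auto simp: mult.assoc[symmetric] intro!: eq_matI)
  also have "minv X * (s \<cdot>\<^sub>m (G * X)) * minv X = s \<cdot>\<^sub>m (minv X * (G * X) * minv X)"
    by (simp add: mult_smult_distrib[of _ N N _ N] mult_smult_assoc_mat[of _ N N _ N]
        mult_carrier_mat[of _ N N _ N])
  also have "minv X * (G * X) * minv X = minv X * G * (X * minv X)"
    by (simp add: assoc_mult_mat[of _ N N _ N _ N] mult_carrier_mat[of _ N N _ N])
  finally show ?thesis
    by (simp add: commutes_upto_def inv right_mult_one_mat[of _ N N] mult_carrier_mat[of _ N N _ N])
qed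

section \<open>Kronecker products\<close>

lemma kron_carrier [simp]:
  "A \<in> carrier_mat a b \<Longrightarrow> B \<in> carrier_mat c d \<Longrightarrow> kron A B \<in> carrier_mat (a * c) (b * d)"
  by (auto simp: kron_def)

text \<open>
  The row-major numbering \<open>p = i * b + j\<close> turns a sum over the index of a Kronecker product into
  a double sum; it is the only combinatorial input to the mixed-product rule below.
\<close>

lemma sum_div_mod:
  fixes a b :: nat and F :: "nat \<Rightarrow> nat \<Rightarrow> 'a::comm_monoid_add"
  shows "(\<Sum>p<a * b. F (p div b) (p mod b)) = (\<Sum>i<a. \<Sum>j<b. F i j)"
proof -
  have row: "(\<Sum>p = i * b..<i * b + b. F (p div b) (p mod b)) = (\<Sum>j<b. F i j)" for i
    by (rule sum.reindex_bij_witness[of _ "\<lambda>j. i * b + j" "\<lambda>p. p - i * b"])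
      (auto simp: div_nat_eqI mult.commute modulo_nat_def)
  show ?thesis
    unfolding sum.nat_group[symmetric] by (intro sum.cong refl row)
qed

lemma div_mod_less:
  fixes a b p :: nat
  assumes "p < a * b"
  shows "p div b < a" "p mod b < b"
  using assms by (auto simp: less_mult_imp_div_less intro!: mod_less_divisor gr0I)

lemma kron_mult:
  assumes A: "A \<in> carrier_mat a b" and C: "C \<in> carrier_mat b c"
    and B: "B \<in> carrier_mat a' b'" and D: "D \<in> carrier_mat b' c'"
  shows "kron A B * kron C D = kron (A * C) (B * (D :: 'a::comm_semiring_0 mat))"
proof (rule eq_matI)
  show "dim_row (kron A B * kron C D) = dim_row (kron (A * C) (B * D))"
    "dim_col (kron A B * kron C D) = dim_col (kron (A * C) (B * D))"
    using assms by (auto simp: kron_def)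
  fix r s assume "r < dim_row (kron (A * C) (B * D))" "s < dim_col (kron (A * C) (B * D))"
  then have r: "r < a * a'" and s: "s < c * c'"
    using assms by (auto simp: kron_def)
  note rs = div_mod_less[OF r] div_mod_less[OF s]
  have "(kron A B * kron C D) $$ (r, s) =
      (\<Sum>p<b * b'. (A $$ (r div a', p div b') * B $$ (r mod a', p mod b')) *
         (C $$ (p div b', s div c') * D $$ (p mod b', s mod c')))"
    using assms r s
    by (auto simp: kron_def scalar_prod_def lessThan_atLeast0 intro!: sum.cong)
  also have "\<dots> = (\<Sum>i<b. \<Sum>j<b'. (A $$ (r div a', i) * B $$ (r mod a', j)) *
         (C $$ (i, s div c') * D $$ (j, s mod c')))"
    by (rule sum_div_mod)
  also have "\<dots> = (\<Sum>i<b. A $$ (r div a', i) * C $$ (i, s div c')) *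
      (\<Sum>j<b'. B $$ (r mod a', j) * D $$ (j, s mod c'))"
    unfolding sum_product by (intro sum.cong refl) (simp add: ac_simps)
  also have "\<dots> = kron (A * C) (B * D) $$ (r, s)"
    using assms r s rs
    by (auto simp: kron_def scalar_prod_def lessThan_atLeast0)
  finally show "(kron A B * kron C D) $$ (r, s) = kron (A * C) (B * D) $$ (r, s)" .
qed

lemma kron_diag:
  fixes f g :: "nat \<Rightarrow> 'a::semiring_0"
  shows "kron (mat_diag a f) (mat_diag b g) = mat_diag (a * b) (\<lambda>p. f (p div b) * g (p mod b))"
    (is "?L = ?R")
proof (rule eq_matI)
  fix r c assume "r < dim_row ?R" "c < dim_col ?R"
  then have r: "r < a * b" and c: "c < a * b"
    by (auto simp: mat_diag_def)
  have "r = c \<longleftrightarrow> r div b = c div b \<and> r mod b = c mod b"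
    by (metis div_mult_mod_eq)
  then show "?L $$ (r, c) = ?R $$ (r, c)"
    using r c div_mod_less[OF r] div_mod_less[OF c] by (auto simp: kron_def mat_diag_def)
qed (auto simp: kron_def mat_diag_def)

lemma kron_one: "kron (1\<^sub>m a) (1\<^sub>m b :: 'a::semiring_1 mat) = 1\<^sub>m (a * b)"
  unfolding mat_diag_one[symmetric] kron_diag by simp

text \<open>
  By the mixed-product rule the two factors are exchanged independently, so their signs multiply.
  This reduces the grid shifts to the one-dimensional matrices \<open>K\<^sub>l\<close>.
\<close>

lemma commutes_upto_kron:
  assumes "commutes_upto a s G X" "commutes_upto b t G' Y"
  shows "commutes_upto (a * b) (s * t) (kron G G') (kron X Y)"
proof -
  have [simp]: "G \<in> carrier_mat a a" "X \<in> carrier_mat a a" "G' \<in> carrier_mat b b"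
    "Y \<in> carrier_mat b b" and eq: "G * X = s \<cdot>\<^sub>m (X * G)" "G' * Y = t \<cdot>\<^sub>m (Y * G')"
    using assms by (auto simp: commutes_upto_def)
  have "kron (s \<cdot>\<^sub>m (X * G)) (t \<cdot>\<^sub>m (Y * G')) = (s * t) \<cdot>\<^sub>m kron (X * G) (Y * G')"
  proof -
    have "dim_row X = a" "dim_col G = a" "dim_row Y = b" "dim_col G' = b"
      by (simp_all add: carrier_matD[of _ a a] carrier_matD[of _ b b])
    then show ?thesis
      by (auto simp: kron_def less_mult_imp_div_less ac_simps div_mod_less intro!: eq_matI)
  qed
  then show ?thesis
    by (simp add: commutes_upto_def kron_mult[of _ a a _ a _ b b _ b] eq)
qed

lemma right_invertible_one: "right_invertible N (1\<^sub>m N)"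
  by (auto simp: right_invertible_def intro!: bexI[of _ "1\<^sub>m N"])

lemma right_invertible_kron:
  assumes "right_invertible a X" "right_invertible b Y"
  shows "right_invertible (a * b) (kron X Y)"
proof -
  from assms obtain X' Y' where
    "X \<in> carrier_mat a a" "X' \<in> carrier_mat a a" "X * X' = 1\<^sub>m a"
    "Y \<in> carrier_mat b b" "Y' \<in> carrier_mat b b" "Y * Y' = 1\<^sub>m b"
    by (auto simp: right_invertible_def)
  then show ?thesis
    by (auto simp: right_invertible_def kron_mult[of _ a a _ a _ b b _ b] kron_one
        intro!: bexI[of _ "kron X' Y'"])
qed

section \<open>Bloch shifts and node parities\<close>

lemma Kmat_index:
  assumes "r < m" "c < m"
  shows "Kmat m \<phi> $$ (r, c) =
    (if r = m - 1 then if c = 0 then exp (\<i> * complex_of_real \<phi>) else 0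
     else if c = Suc r then 1 else 0)"
  using assms by (auto simp: Kmat_def)

lemma Kmat_carrier: "0 < m \<Longrightarrow> Kmat m \<phi> \<in> carrier_mat m m"
  by (auto simp: Kmat_def)

lemma right_invertible_Kmat:
  assumes m: "0 < m"
  shows "right_invertible m (Kmat m \<phi>)"
proof -
  \<comment> \<open>\<open>L\<close> is the conjugate transpose: a Bloch shift is unitary.\<close>
  define L where "L = mat m m (\<lambda>(r, c).
    if c = m - 1 then if r = 0 then exp (- (\<i> * complex_of_real \<phi>)) else 0
    else if r = Suc c then 1 else 0)"
  have "Kmat m \<phi> * L = 1\<^sub>m m"
  proof (rule eq_matI)
    fix r c assume "r < dim_row (1\<^sub>m m :: complex mat)" "c < dim_col (1\<^sub>m m :: complex mat)"
    then have r: "r < m" and c: "c < m" by auto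
    \<comment> \<open>Row \<open>r\<close> of the shift has its only nonzero entry in column \<open>r'\<close>.\<close>
    define r' where "r' = (if r = m - 1 then 0 else Suc r)"
    have r': "r' < m" using r m by (auto simp: r'_def)
    have "(Kmat m \<phi> * L) $$ (r, c) = (\<Sum>k<m. Kmat m \<phi> $$ (r, k) * L $$ (k, c))"
      using r c Kmat_carrier[OF m, of \<phi>]
      by (auto simp: L_def scalar_prod_def lessThan_atLeast0 intro!: sum.cong)
    also have "\<dots> = (\<Sum>k<m. if k = r' then Kmat m \<phi> $$ (r, r') * L $$ (r', c) else 0)"
      using r by (intro sum.cong refl) (auto simp: Kmat_index r'_def)
    also have "\<dots> = Kmat m \<phi> $$ (r, r') * L $$ (r', c)"
      using r' by simp
    also have "\<dots> = 1\<^sub>m m $$ (r, c)"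
      using r c r' by (auto simp: Kmat_index r'_def L_def exp_minus)
    finally show "(Kmat m \<phi> * L) $$ (r, c) = 1\<^sub>m m $$ (r, c)" .
  qed (use Kmat_carrier[OF m, of \<phi>] in \<open>auto simp: L_def\<close>)
  moreover have "L \<in> carrier_mat m m"
    by (simp add: L_def)
  ultimately show ?thesis
    using Kmat_carrier[OF m] by (auto simp: right_invertible_def)
qed

definition alternating :: "nat \<Rightarrow> complex mat" where
  "alternating m = mat_diag m (\<lambda>i. (- 1) ^ i)"

lemma alternating_carrier [simp]: "alternating m \<in> carrier_mat m m"
  by (simp add: alternating_def)

text \<open>
  Every nonzero entry \<open>(r, c)\<close> of the shift joins indices of opposite parity. Above the diagonal
  \<open>c = r + 1\<close>; the wrap-around entry sits at \<open>(m - 1, 0)\<close>, and here the evenness of \<open>m\<close> enters.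
\<close>

lemma alternating_anticommutes_Kmat:
  assumes m: "0 < m" "even m"
  shows "commutes_upto m (- 1) (alternating m) (Kmat m \<phi>)"
proof -
  \<comment> \<open>the sign in the wrap-around row\<close>
  have last: "(- 1 :: complex) ^ (m - Suc 0) = - 1"
    using m by (intro neg_one_odd_power) auto
  show ?thesis
    using m Kmat_carrier[OF m(1), of \<phi>]
    by (auto simp: commutes_upto_def alternating_def mat_diag_mult_left[of _ m m]
        mat_diag_mult_right[of _ m m] Kmat_index last intro!: eq_matI)
qed

text \<open>
  Written as Kronecker products, the parities split along the same three factors as the shifts.
\<close>

lemma parity12_kron:
  "parity12 n = kron (kron (1\<^sub>m (n 3)) (alternating (n 2))) (alternating (n 1))"
  unfolding parity12_def alternating_def mat_diag_one[symmetric] kron_diag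
  by (simp add: gridsize_def power_add ac_simps)

lemma parity13_kron:
  "parity13 n = kron (kron (alternating (n 3)) (1\<^sub>m (n 2))) (alternating (n 1))"
  unfolding parity13_def alternating_def mat_diag_one[symmetric] kron_diag
  by (simp add: gridsize_def power_add ac_simps div_mult2_eq)

lemma H_right_invertible:
  assumes "\<And>l. l \<in> {1, 2, 3} \<Longrightarrow> 0 < n l"
  shows "right_invertible (gridsize n) (H1 n \<kappa>)" "right_invertible (gridsize n) (H2 n \<kappa>)"
    "right_invertible (gridsize n) (H3 n \<kappa>)"
proof -
  have N: "gridsize n = n 3 * n 2 * n 1"
    by (simp add: gridsize_def)
  show "right_invertible (gridsize n) (H1 n \<kappa>)" "right_invertible (gridsize n) (H2 n \<kappa>)"
    "right_invertible (gridsize n) (H3 n \<kappa>)"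
    unfolding N H1_def H2_def H3_def Bloch_K_def
    by (intro right_invertible_kron right_invertible_one right_invertible_Kmat assms; simp)+
qed

lemma parity_commutes_upto_H:
  assumes pos: "\<And>l. l \<in> {1, 2, 3} \<Longrightarrow> 0 < n l" and ev: "\<And>l. l \<in> {1, 2, 3} \<Longrightarrow> even (n l)"
  shows "commutes_upto (gridsize n) (- 1) (parity12 n) (H1 n \<kappa>)"
    "commutes_upto (gridsize n) (- 1) (parity12 n) (H2 n \<kappa>)"
    "commutes_upto (gridsize n) 1 (parity12 n) (H3 n \<kappa>)"
    "commutes_upto (gridsize n) (- 1) (parity13 n) (H1 n \<kappa>)"
    "commutes_upto (gridsize n) 1 (parity13 n) (H2 n \<kappa>)"
    "commutes_upto (gridsize n) (- 1) (parity13 n) (H3 n \<kappa>)"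
proof -
  have N: "gridsize n = n 3 * n 2 * n 1"
    by (simp add: gridsize_def)
  have K: "commutes_upto (n l) (- 1) (alternating (n l)) (Bloch_K n \<kappa> l)" if "l \<in> {1, 2, 3}" for l
    unfolding Bloch_K_def using that by (intro alternating_anticommutes_Kmat pos ev)
  have KI: "commutes_upto (n l) 1 (1\<^sub>m (n l)) (Bloch_K n \<kappa> l)" if "l \<in> {1, 2, 3}" for l
    using K[OF that] by (auto simp: commutes_upto_def intro!: eq_matI)
  have I: "commutes_upto (n l) 1 (1\<^sub>m (n l)) (1\<^sub>m (n l))"
    "commutes_upto (n l) 1 (alternating (n l)) (1\<^sub>m (n l))" for l
    by (simp_all add: commutes_upto_one)
  note kk = commutes_upto_kron[OF commutes_upto_kron]
  note d = N parity12_kron parity13_kron H1_def H2_def H3_def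
  show "commutes_upto (gridsize n) (- 1) (parity12 n) (H1 n \<kappa>)"
    using kk[OF I(1)[of 3] I(2)[of 2] K[of 1]] by (simp add: d)
  show "commutes_upto (gridsize n) (- 1) (parity12 n) (H2 n \<kappa>)"
    using kk[OF I(1)[of 3] K[of 2] I(2)[of 1]] by (simp add: d)
  show "commutes_upto (gridsize n) 1 (parity12 n) (H3 n \<kappa>)"
    using kk[OF KI[of 3] I(2)[of 2] I(2)[of 1]] by (simp add: d)
  show "commutes_upto (gridsize n) (- 1) (parity13 n) (H1 n \<kappa>)"
    using kk[OF I(2)[of 3] I(1)[of 2] K[of 1]] by (simp add: d)
  show "commutes_upto (gridsize n) 1 (parity13 n) (H2 n \<kappa>)"
    using kk[OF I(2)[of 3] KI[of 2] I(2)[of 1]] by (simp add: d)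
  show "commutes_upto (gridsize n) (- 1) (parity13 n) (H3 n \<kappa>)"
    using kk[OF K[of 3] I(1)[of 2] I(2)[of 1]] by (simp add: d)
qed

text \<open>
  Each body-diagonal shift contains one step in every direction. As \<open>minv\<close> keeps the sign of a
  step, all four shifts have the same total sign \<open>s3 * s2 * s1\<close>. Their differences with the
  identity, and linear combinations of these, commute with \<open>G\<close> because that sign is \<open>1\<close>, the sign of the identity.
\<close>

lemma Dcal_commutes:
  assumes pos: "\<And>l. l \<in> {1, 2, 3} \<Longrightarrow> 0 < n l"
    and H: "commutes_upto (gridsize n) s1 G (H1 n \<kappa>)" "commutes_upto (gridsize n) s2 G (H2 n \<kappa>)"
      "commutes_upto (gridsize n) s3 G (H3 n \<kappa>)"
    and s: "s2 * s2 = 1" "s3 * s3 = 1" "s3 * s2 * s1 = 1"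
  shows "commutes_upto (gridsize n) 1 G (Dcal n h \<kappa> Alat m)"
proof -
  let ?N = "gridsize n"
  have inv: "commutes_upto ?N s2 G (minv (H2 n \<kappa>))" "commutes_upto ?N s3 G (minv (H3 n \<kappa>))"
    using commutes_upto_minv[OF H(2) s(1)] commutes_upto_minv[OF H(3) s(2)]
      H_right_invertible[of n, OF pos] by blast+
  have G: "G \<in> carrier_mat ?N ?N"
    using H by (simp add: commutes_upto_def)
  note m3 = commutes_upto_mult[OF commutes_upto_mult, of ?N s3 G _ s2 _ s1, unfolded s]
  have S: "commutes_upto ?N 1 G (Sd1 n \<kappa>)" "commutes_upto ?N 1 G (Sd2 n \<kappa>)"
    "commutes_upto ?N 1 G (Sd3 n \<kappa>)" "commutes_upto ?N 1 G (Sd4 n \<kappa>)"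
    unfolding Sd1_def Sd2_def Sd3_def Sd4_def by (intro m3 H inv)+
  have "commutes_upto ?N 1 G (diag_diff n h X)" if "commutes_upto ?N 1 G X" for X
    unfolding diag_diff_def
    by (intro commutes_upto_smult commutes_upto_diff commutes_upto_one that G)
  note D = this[OF S(1)] this[OF S(2)] this[OF S(3)] this[OF S(4)]
  have "commutes_upto ?N 1 G (Dtilde n h \<kappa> l)" for l
    unfolding Dtilde_def Let_def
    by (intro commutes_upto_smult)
      (auto intro!: D commutes_upto_add commutes_upto_diff)
  then show ?thesis
    unfolding Dcal_def Dhat_def
    by (intro commutes_upto_add commutes_upto_smult)
qed

section \<open>Diagonal matrices on stacked grid functions\<close>

text \<open>
  Over a domain, intertwining two diagonal matrices means that nonzero entries of \<open>X\<close> only join a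
  row and a column with the same diagonal value. The block, adjoint and nodewise matrices below are
  all handled through this entrywise criterion; it also covers rectangular \<open>X\<close> such as \<open>B\<^sub>h\<close>.
\<close>

lemma diag_intertwines_iff:
  fixes X :: "'a::comm_semiring_0 mat"
  assumes "X \<in> carrier_mat p q"
  shows "mat_diag p g * X = X * mat_diag q g' \<longleftrightarrow>
    (\<forall>r<p. \<forall>c<q. g r * X $$ (r, c) = X $$ (r, c) * g' c)"
  using assms by (auto simp: mat_diag_mult_left mat_diag_mult_right mat_eq_iff)

lemma block_mat_intertwines:
  fixes g :: "nat \<Rightarrow> 'a::comm_semiring_0"
  assumes rect: "\<And>Xs. Xs \<in> set Bs \<Longrightarrow> length Xs = b"
    and ne: "Bs \<noteq> []"
    and comm: "\<And>Xs X. Xs \<in> set Bs \<Longrightarrow> X \<in> set Xs \<Longrightarrow>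
      X \<in> carrier_mat N N \<and> mat_diag N g * X = X * mat_diag N g"
  shows "mat_diag (length Bs * N) (\<lambda>p. g (p mod N)) * block_mat N Bs
    = block_mat N Bs * mat_diag (b * N) (\<lambda>p. g (p mod N))"
proof -
  have hd: "length (hd Bs) = b"
    using rect ne by simp
  then have B: "block_mat N Bs \<in> carrier_mat (length Bs * N) (b * N)"
    by (simp add: block_mat_def)
  have "g (r mod N) * block_mat N Bs $$ (r, c) = block_mat N Bs $$ (r, c) * g (c mod N)"
    if r: "r < length Bs * N" and c: "c < b * N" for r c
  proof -
    note rc = div_mod_less[OF r] div_mod_less[OF c]
    let ?X = "Bs ! (r div N) ! (c div N)"
    have "Bs ! (r div N) \<in> set Bs" using rc by simp
    moreover from this have "?X \<in> set (Bs ! (r div N))" using rc rect by simp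
    ultimately have "?X \<in> carrier_mat N N" "mat_diag N g * ?X = ?X * mat_diag N g"
      using comm by blast+
    with rc r c hd show ?thesis
      by (simp add: diag_intertwines_iff block_mat_def)
  qed
  then show ?thesis
    unfolding diag_intertwines_iff[OF B] by blast
qed

lemma mat_adjoint_carrier: "A \<in> carrier_mat p q \<Longrightarrow> mat_adjoint A \<in> carrier_mat q p"
  by (auto simp: mat_adjoint_def)

lemma mat_adjoint_index:
  assumes "A \<in> carrier_mat p q" "r < q" "c < p"
  shows "mat_adjoint A $$ (r, c) = conjugate (A $$ (c, r))"
  using assms by (auto simp: mat_adjoint_def mat_of_rows_index)

lemma adjoint_intertwines:
  fixes X :: "complex mat"
  assumes X: "X \<in> carrier_mat p q" and "mat_diag p g * X = X * mat_diag q g'"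
    and real: "\<And>r. cnj (g r) = g r" "\<And>c. cnj (g' c) = g' c"
  shows "mat_diag q g' * mat_adjoint X = mat_adjoint X * mat_diag p g"
proof -
  have eq: "g c * X $$ (c, r) = X $$ (c, r) * g' r" if "c < p" "r < q" for r c
    using assms(2) that unfolding diag_intertwines_iff[OF X] by blast
  have "g' r * cnj (X $$ (c, r)) = cnj (X $$ (c, r)) * g c" if "c < p" "r < q" for r c
    using arg_cong[OF eq[OF that], of cnj] by (simp only: real complex_cnj_mult mult.commute)
  then show ?thesis
    unfolding diag_intertwines_iff[OF mat_adjoint_carrier[OF X]]
    by (simp add: mat_adjoint_index[OF X])
qed

text \<open>
  Applying \<open>C\<close> to a unit vector supported at one node gives zero at all other nodes. So every entry
  of \<open>C\<close> joining different nodes vanishes, and on the others the diagonal values agree, because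
  they depend on the node alone.
\<close>

lemma nodewise_local_commutes:
  assumes C: "nodewise_local N k C"
  shows "mat_diag (k * N) (\<lambda>p. g (p mod N)) * C = C * mat_diag (k * N) (\<lambda>p. g (p mod N))"
proof -
  from C obtain L where Cc: "C \<in> carrier_mat (k * N) (k * N)"
    and L: "\<And>x. x < N \<Longrightarrow> L x \<in> carrier_mat k k"
    and loc: "\<And>v x. v \<in> carrier_vec (k * N) \<Longrightarrow> x < N \<Longrightarrow>
      node_values N k (C *\<^sub>v v) x = L x *\<^sub>v node_values N k v x"
    by (auto simp: nodewise_local_def)
  have zero: "C $$ (r, c) = 0" if r: "r < k * N" and c: "c < k * N" and ne: "r mod N \<noteq> c mod N"
    for r c
  proof -
    note rd = div_mod_less[OF r]
    have lt: "i * N + r mod N < k * N" if "i < k" for i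
    proof -
      have "i * N + r mod N < Suc i * N" using rd by simp
      also have "\<dots> \<le> k * N" using that by (intro mult_le_mono1) simp
      finally show ?thesis .
    qed
    \<comment> \<open>The unit vector \<open>c\<close> vanishes at the node of \<open>r\<close>, hence so does its image under \<open>C\<close>.\<close>
    have [simp]: "node_values N k (unit_vec (k * N) c) (r mod N) = 0\<^sub>v k"
      using ne rd lt c by (auto simp: node_values_def unit_vec_def intro!: eq_vecI)
    have "node_values N k (C *\<^sub>v unit_vec (k * N) c) (r mod N) = L (r mod N) *\<^sub>v 0\<^sub>v k"
      using loc[OF unit_vec_carrier rd(2), of c] by simp
    moreover have "C *\<^sub>v unit_vec (k * N) c = col C c"
      using Cc c by (auto intro!: eq_vecI)
    ultimately have "node_values N k (col C c) (r mod N) $ (r div N) = 0"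
      using rd L[of "r mod N"] by simp
    then show ?thesis
      using rd Cc c r by (simp add: node_values_def)
  qed
  show ?thesis
    unfolding diag_intertwines_iff[OF Cc] by (metis zero mult_zero_left mult_zero_right mult.commute)
qed

lemma Bh_carrier: "Bh n h \<kappa> Alat \<in> carrier_mat (3 * gridsize n) (6 * gridsize n)"
  unfolding Bh_def Let_def block_mat_def by (rule carrier_matI) simp_all

lemma Ah_commutes:
  assumes D: "\<And>m. commutes_upto (gridsize n) 1 (mat_diag (gridsize n) g) (Dcal n h \<kappa> Alat m)"
    and real: "\<And>p. cnj (g p) = g p"
    and C: "nodewise_local (gridsize n) 6 C"
  shows "mat_diag (3 * gridsize n) (\<lambda>p. g (p mod gridsize n)) * Ah n h \<kappa> Alat C
    = Ah n h \<kappa> Alat C * mat_diag (3 * gridsize n) (\<lambda>p. g (p mod gridsize n))"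
proof -
  define N where "N = gridsize n"
  define G where "G k = mat_diag (k * N) (\<lambda>p. g (p mod N))" for k
  define B where "B = Bh n h \<kappa> Alat"
  have G: "G k \<in> carrier_mat (k * N) (k * N)" for k
    by (simp add: G_def)
  have B: "B \<in> carrier_mat (3 * N) (6 * N)"
    by (simp add: B_def N_def Bh_carrier)
  have Ccar: "C \<in> carrier_mat (6 * N) (6 * N)"
    using C by (simp add: nodewise_local_def N_def)
  have Dc: "Dcal n h \<kappa> Alat m \<in> carrier_mat N N \<and>
      mat_diag N g * Dcal n h \<kappa> Alat m = Dcal n h \<kappa> Alat m * mat_diag N g" for m
    using D[of m] by (auto simp: commutes_upto_def N_def intro!: eq_matI)
  have Z: "0\<^sub>m N N \<in> carrier_mat N N \<and>
      mat_diag N g * 0\<^sub>m N N = 0\<^sub>m N N * mat_diag N g"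
    by (simp add: right_mult_zero_mat[of _ N N] left_mult_zero_mat[of _ N N])
  define Bs where "Bs = (let D = Dcal n h \<kappa> Alat; Z = 0\<^sub>m N N in
        [[D 1, Z,   Z,   Z,   D 3, D 2],
         [Z,   D 2, Z,   D 3, Z,   D 1],
         [Z,   Z,   D 3, D 2, D 1, Z  ]])"
  have BBs: "B = block_mat N Bs"
    by (simp add: B_def Bh_def Bs_def N_def Let_def)
  have "length Bs = 3"
    by (simp add: Bs_def Let_def)
  moreover have "mat_diag (length Bs * N) (\<lambda>p. g (p mod N)) * block_mat N Bs
      = block_mat N Bs * mat_diag (6 * N) (\<lambda>p. g (p mod N))"
    using Dc Z by (intro block_mat_intertwines) (auto simp: Bs_def Let_def)
  ultimately have GB: "G 3 * B = B * G 6"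
    by (simp add: G_def BBs)
  have GC: "G 6 * C = C * G 6"
    using nodewise_local_commutes[OF C] by (simp add: G_def N_def)
  have GA: "G 6 * mat_adjoint B = mat_adjoint B * G 3"
    using GB unfolding G_def by (intro adjoint_intertwines B) (auto simp: real)
  note car = G[of 3] G[of 6] B Ccar mat_adjoint_carrier[OF B]
  have BC: "B * C \<in> carrier_mat (3 * N) (6 * N)"
    using car by simp
  \<comment> \<open>\<open>G 3\<close> enters on the left, becomes \<open>G 6\<close> between the factors, and leaves as \<open>G 3\<close>.\<close>
  have "G 3 * (B * C * mat_adjoint B) = G 3 * B * C * mat_adjoint B"
    using assoc_mult_mat[OF car(1) BC car(5)] assoc_mult_mat[OF car(1,3,4)] by simp
  also have "\<dots> = B * (G 6 * C) * mat_adjoint B"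
    unfolding GB using assoc_mult_mat[OF car(3,2,4)] by simp
  also have "\<dots> = B * C * G 6 * mat_adjoint B"
    unfolding GC using assoc_mult_mat[OF car(3,4,2)] by simp
  also have "\<dots> = B * C * mat_adjoint B * G 3"
    using assoc_mult_mat[OF BC car(2,5)] assoc_mult_mat[OF BC car(5,1)] GA by simp
  finally show ?thesis
    by (simp add: G_def Ah_def B_def N_def)
qed

section \<open>Orthogonal decomposition along coordinate labels\<close>

text \<open>
  A labelling of the coordinates splits \<open>\<complex>\<^sup>m\<close> into coordinate subspaces. The component with
  label \<open>i\<close> of a vector is forced: in any decomposition, only the summand with label \<open>lab p\<close> can
  contribute to coordinate \<open>p\<close>, so it carries the whole entry there.
\<close>

lemma orthogonal_direct_sum_labels:
  fixes lab :: "nat \<Rightarrow> 'i"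
  assumes fin: "finite I" and lab: "\<And>p. p < m \<Longrightarrow> lab p \<in> I"
  shows "orthogonal_direct_sum m I
    (\<lambda>i. {v \<in> carrier_vec m. \<forall>p<m. v $ p \<noteq> 0 \<longrightarrow> lab p = i})"
    (is "orthogonal_direct_sum m I ?V")
  unfolding orthogonal_direct_sum_def
proof (intro conjI ballI impI)
  fix i assume "i \<in> I"
  interpret vec_space "TYPE(complex)" m .
  show "VectorSpace.subspace class_ring (?V i) (module_vec TYPE(complex) m)"
    by unfold_locales (auto simp: module_vec_def)
next
  fix i j v w assume "i \<noteq> j" and v: "v \<in> ?V i" and w: "w \<in> ?V j"
  then have "v $ p * conjugate w $ p = 0" if "p < m" for p
    using that by auto
  then show "v \<bullet>c w = 0"
    using w by (auto simp: scalar_prod_def intro!: sum.neutral)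
next
  fix v :: "complex vec" assume v: "v \<in> carrier_vec m"
  define part where "part i = vec m (\<lambda>p. if lab p = i then v $ p else 0)" for i
  have part_V: "part i \<in> ?V i" for i
    by (auto simp: part_def)
  have entry: "finsum_vec TYPE(complex) m f I $ p = f (lab p) $ p"
    if f: "f \<in> (\<Pi>\<^sub>E i\<in>I. ?V i)" and p: "p < m" for f p
  proof -
    have "finsum_vec TYPE(complex) m f I $ p = (\<Sum>i\<in>I. f i $ p)"
      using f by (intro index_finsum_vec fin p) auto
    also have "\<dots> = (\<Sum>i\<in>I. if i = lab p then f (lab p) $ p else 0)"
      using f p by (intro sum.cong refl) (fastforce simp: PiE_iff)
    finally show ?thesis
      using fin lab[OF p] by simp
  qed
  have finsum_dim: "dim_vec (finsum_vec TYPE(complex) m f I) = m"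
    if "f \<in> (\<Pi>\<^sub>E i\<in>I. ?V i)" for f
    using that by (intro carrier_vecD finsum_vec_closed) auto
  show "\<exists>!f. f \<in> (\<Pi>\<^sub>E i\<in>I. ?V i) \<and> v = finsum_vec TYPE(complex) m f I"
  proof (intro ex1I[of _ "restrict part I"] conjI)
    show mem: "restrict part I \<in> (\<Pi>\<^sub>E i\<in>I. ?V i)"
      using part_V by auto
    show "v = finsum_vec TYPE(complex) m (restrict part I) I"
      using v finsum_dim[OF mem] entry[OF mem] lab by (intro eq_vecI) (auto simp: part_def)
  next
    fix f assume asm: "f \<in> (\<Pi>\<^sub>E i\<in>I. ?V i) \<and> v = finsum_vec TYPE(complex) m f I"
    then have f: "f \<in> (\<Pi>\<^sub>E i\<in>I. ?V i)" and vf: "v = finsum_vec TYPE(complex) m f I"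
      by blast+
    have "f i = part i" if i: "i \<in> I" for i
    proof (rule eq_vecI)
      have fi: "f i \<in> ?V i" using f i by (auto simp: PiE_iff)
      then show "dim_vec (f i) = dim_vec (part i)" by (auto simp: part_def)
      fix p assume "p < dim_vec (part i)"
      then have p: "p < m" by (simp add: part_def)
      show "f i $ p = part i $ p"
        using entry[OF f p] fi p by (auto simp: part_def vf)
    qed
    with f show "f = restrict part I"
      by (auto simp: PiE_iff extensional_def restrict_def)
  qed
qed

lemma diag_eigenvector_iff:
  fixes v :: "'a::idom vec"
  assumes "v \<in> carrier_vec m"
  shows "mat_diag m g *\<^sub>v v = \<sigma> \<cdot>\<^sub>v v \<longleftrightarrow> (\<forall>p<m. v $ p \<noteq> 0 \<longrightarrow> g p = \<sigma>)"
proof -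
  have "(mat_diag m g *\<^sub>v v) $ p = g p * v $ p" if "p < m" for p
    using that assms
    by (simp add: mat_diag_def scalar_prod_def if_distrib[of "\<lambda>x. x * _"] sum.delta cong: if_cong)
  then have "mat_diag m g *\<^sub>v v = \<sigma> \<cdot>\<^sub>v v \<longleftrightarrow> (\<forall>p<m. g p * v $ p = \<sigma> * v $ p)"
    using assms by (auto simp: vec_eq_iff mat_diag_def)
  then show ?thesis by auto
qed

lemma commuting_preserves_eigenvector:
  fixes A :: "'a::field mat"
  assumes "A \<in> carrier_mat m m" "G \<in> carrier_mat m m" "A * G = G * A" "v \<in> carrier_vec m"
    "G *\<^sub>v v = \<sigma> \<cdot>\<^sub>v v"
  shows "G *\<^sub>v (A *\<^sub>v v) = \<sigma> \<cdot>\<^sub>v (A *\<^sub>v v)"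
proof -
  have "G *\<^sub>v (A *\<^sub>v v) = A *\<^sub>v (G *\<^sub>v v)"
    using assoc_mult_mat_vec[OF assms(1,2,4)] assoc_mult_mat_vec[OF assms(2,1,4)] assms(3) by simp
  also have "\<dots> = \<sigma> \<cdot>\<^sub>v (A *\<^sub>v v)"
    unfolding assms(5) by (rule mult_mat_vec[OF assms(1,4)])
  finally show ?thesis .
qed

lemma parity_v_diag:
  assumes "P = mat_diag N g"
  shows "kron (1\<^sub>m 3) P = mat_diag (3 * N) (\<lambda>p. g (p mod N) :: complex)"
  unfolding assms mat_diag_one[symmetric] kron_diag by simp

section \<open>The parity decomposition\<close>

theorem theorem4p1:
  fixes n :: "nat \<Rightarrow> nat" and h \<kappa> :: "nat \<Rightarrow> real"
    and Alat :: "real mat" and C M :: "complex mat"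
  assumes "\<And>l. l \<in> {1, 2, 3} \<Longrightarrow> 0 < n l"
    and "\<And>l. l \<in> {1, 2, 3} \<Longrightarrow> even (n l)"
    and "\<And>l. l \<in> {1, 2, 3} \<Longrightarrow> 0 < h l"
    and "Alat \<in> carrier_mat 3 3" and "invertible_mat Alat"
    and "nodewise_local (gridsize n) 6 C"
    and "nodewise_local (gridsize n) 3 M"
  shows "(\<forall>\<Gamma> \<in> {parity12_v n, parity13_v n}.
      Ah n h \<kappa> Alat C * \<Gamma> = \<Gamma> * Ah n h \<kappa> Alat C \<and> M * \<Gamma> = \<Gamma> * M) \<and>
    orthogonal_direct_sum (3 * gridsize n) ({1, - 1} \<times> {1, - 1})
      (\<lambda>(\<sigma>12, \<sigma>13). parity_space n \<sigma>12 \<sigma>13) \<and>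
    (\<forall>\<sigma>12 \<in> {1, - 1}. \<forall>\<sigma>13 \<in> {1, - 1}. \<forall>v \<in> parity_space n \<sigma>12 \<sigma>13.
       Ah n h \<kappa> Alat C *\<^sub>v v \<in> parity_space n \<sigma>12 \<sigma>13 \<and>
       M *\<^sub>v v \<in> parity_space n \<sigma>12 \<sigma>13)"
proof -
  define N where "N = gridsize n"
  define g12 g13 :: "nat \<Rightarrow> complex"
    where "g12 = (\<lambda>p. (- 1) ^ (p mod n 1 + p div n 1 mod n 2))"
      and "g13 = (\<lambda>p. (- 1) ^ (p mod n 1 + p div (n 1 * n 2)))"
  have P: "parity12 n = mat_diag N g12" "parity13 n = mat_diag N g13"
    by (simp_all add: parity12_def parity13_def g12_def g13_def N_def)
  have Pv: "parity12_v n = mat_diag (3 * N) (\<lambda>p. g12 (p mod N))"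
    "parity13_v n = mat_diag (3 * N) (\<lambda>p. g13 (p mod N))"
    by (simp_all add: parity12_v_def parity13_v_def parity_v_diag[OF P(1)] parity_v_diag[OF P(2)])
  have sign: "g12 p \<in> {1, - 1}" "g13 p \<in> {1, - 1}" for p
    using minus_one_power_iff[where 'a = complex] by (auto simp: g12_def g13_def)
  have real: "cnj (g12 p) = g12 p" "cnj (g13 p) = g13 p" for p
    using sign[of p] by auto
  note H = parity_commutes_upto_H[OF assms(1,2)]
  have D: "commutes_upto (gridsize n) 1 (parity12 n) (Dcal n h \<kappa> Alat m)"
    "commutes_upto (gridsize n) 1 (parity13 n) (Dcal n h \<kappa> Alat m)" for m
    using Dcal_commutes[OF assms(1) H(1,2,3)] Dcal_commutes[OF assms(1) H(4,5,6)] by simp_all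
  note A = Ah_commutes[OF D(1)[unfolded P N_def] real(1) assms(6), folded N_def Pv]
    Ah_commutes[OF D(2)[unfolded P N_def] real(2) assms(6), folded N_def Pv]
  note M = nodewise_local_commutes[OF assms(7)[folded N_def], of g12, folded Pv]
    nodewise_local_commutes[OF assms(7)[folded N_def], of g13, folded Pv]
  have comm: "\<forall>\<Gamma> \<in> {parity12_v n, parity13_v n}.
      Ah n h \<kappa> Alat C * \<Gamma> = \<Gamma> * Ah n h \<kappa> Alat C \<and> M * \<Gamma> = \<Gamma> * M"
    using A M by (auto simp: Pv)
  \<comment> \<open>A common eigenvector may be nonzero only where both diagonal entries equal its eigenvalues.\<close>
  define lab where "lab p = (g12 (p mod N), g13 (p mod N))" for p
  have "(\<lambda>(\<sigma>12, \<sigma>13). parity_space n \<sigma>12 \<sigma>13) =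
      (\<lambda>\<sigma>. {v \<in> carrier_vec (3 * N). \<forall>p<3 * N. v $ p \<noteq> 0 \<longrightarrow> lab p = \<sigma>})"
    by (auto simp: fun_eq_iff parity_space_def Pv diag_eigenvector_iff lab_def N_def[symmetric])
  moreover have "orthogonal_direct_sum (3 * N) ({1, - 1} \<times> {1, - 1})
      (\<lambda>\<sigma>. {v \<in> carrier_vec (3 * N). \<forall>p<3 * N. v $ p \<noteq> 0 \<longrightarrow> lab p = \<sigma>})"
    using sign by (intro orthogonal_direct_sum_labels) (auto simp: lab_def)
  ultimately have decomp: "orthogonal_direct_sum (3 * gridsize n) ({1, - 1} \<times> {1, - 1})
      (\<lambda>(\<sigma>12, \<sigma>13). parity_space n \<sigma>12 \<sigma>13)"
    by (simp add: N_def)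
  have Acar: "Ah n h \<kappa> Alat C \<in> carrier_mat (3 * N) (3 * N)"
    using Bh_carrier[of n h \<kappa> Alat] mat_adjoint_carrier[OF Bh_carrier[of n h \<kappa> Alat]]
    unfolding Ah_def N_def carrier_mat_def by simp
  have Mcar: "M \<in> carrier_mat (3 * N) (3 * N)"
    using assms(7) by (simp add: nodewise_local_def N_def)
  have inv: "X *\<^sub>v v \<in> parity_space n \<sigma>12 \<sigma>13"
    if X: "X \<in> carrier_mat (3 * N) (3 * N)" "X * parity12_v n = parity12_v n * X"
      "X * parity13_v n = parity13_v n * X" and v: "v \<in> parity_space n \<sigma>12 \<sigma>13" for X v \<sigma>12 \<sigma>13
  proof -
    have "parity12_v n \<in> carrier_mat (3 * N) (3 * N)" "parity13_v n \<in> carrier_mat (3 * N) (3 * N)"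
      by (simp_all add: Pv)
    with X v show ?thesis
      by (auto simp: parity_space_def N_def[symmetric] intro: commuting_preserves_eigenvector)
  qed
  show ?thesis
    using comm decomp inv[OF Acar] inv[OF Mcar] by blast
qed

end
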